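(* Let $(\Omega,\nu)=\prod_{t=1}^n(\Omega_t,\nu_t)$ be a finite product probability space, let $f\in L^2(\Omega,\nu)$, let $q>2$ be an even integer and $0\le\rho\le\frac{1}{8q^{1.5}}$. Then \[\|\mathrm{T}_\rho f\|_q^q\le\sum_{S\subseteq[n]}\sigma_S^{2-q}\|\mathrm{L}_S[f]\|_2^q.\]
   Context: Each $(\Omega_t,\nu_t)$ is a finite probability space with $p_t=\min_{\omega\in\Omega_t}\nu_t(\omega)\in(0,\tfrac12)$; $\sigma_t=\sqrt{p_t(1-p_t)}$ and $\sigma_S=\prod_{t\in S}\sigma_t$. For $J\subseteq[n]$, $(\mathrm{E}_Jf)(\omega)=\mathbb{E}[f(\omega)\mid\omega_{[n]\setminus J}]$ (averaging over the coordinates in $J$). The Efron–Stein decomposition is $f=\sum_S f^{=S}$ with $f^{=S}=\sum_{J\subseteq S}(-1)^{|S\setminus J|}\mathrm{E}_{[n]\setminus J}f$. The noise operator is $\mathrm{T}_\rho f=\sum_S\rho^{|S|}f^{=S}$ (equivalently, each coordinate is kept with probability $\rho$ and otherwise resampled from $\nu_t$). $\mathrm{L}_tf=f-\mathrm{E}_{\{t\}}f$, $\mathrm{L}_S$ is the composition of $\mathrm{L}_t$ over $t\in S$; equivalently $\mathrm{L}_Sf=\sum_{T\supseteq S}f^{=T}$. *)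

theory Defs
  imports "HOL-Probability.Probability"
begin

text \<open>
  The factors \<open>(\<Omega> t, \<nu> t)\<close>, for \<open>t \<in> {1..n}\<close>, share one ambient type \<open>'a\<close>; any finite family of
  finite sets embeds into such a type. A function on the product space is a function on
  \<open>nat \<Rightarrow> 'a\<close>, of which only the values on \<open>PiE {1..n} \<Omega>\<close> matter: the default value
  \<open>undefined\<close> makes this set contain the support of the product measure.
\<close>

definition prod_space :: "nat \<Rightarrow> (nat \<Rightarrow> 'a pmf) \<Rightarrow> (nat \<Rightarrow> 'a) pmf" where
  "prod_space n \<nu> = Pi_pmf {1..n} undefined \<nu>"

definition Lq_norm :: "nat \<Rightarrow> (nat \<Rightarrow> 'a pmf) \<Rightarrow> real \<Rightarrow> ((nat \<Rightarrow> 'a) \<Rightarrow> real) \<Rightarrow> real" where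
  "Lq_norm n \<nu> r f =
     (measure_pmf.expectation (prod_space n \<nu>) (\<lambda>\<omega>. \<bar>f \<omega>\<bar> powr r)) powr (1 / r)"

definition min_prob :: "(nat \<Rightarrow> 'a set) \<Rightarrow> (nat \<Rightarrow> 'a pmf) \<Rightarrow> nat \<Rightarrow> real" where
  "min_prob \<Omega> \<nu> t = Min (pmf (\<nu> t) ` \<Omega> t)"

definition sigma :: "(nat \<Rightarrow> 'a set) \<Rightarrow> (nat \<Rightarrow> 'a pmf) \<Rightarrow> nat \<Rightarrow> real" where
  "sigma \<Omega> \<nu> t = sqrt (min_prob \<Omega> \<nu> t * (1 - min_prob \<Omega> \<nu> t))"

definition sigma_set :: "(nat \<Rightarrow> 'a set) \<Rightarrow> (nat \<Rightarrow> 'a pmf) \<Rightarrow> nat set \<Rightarrow> real" where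
  "sigma_set \<Omega> \<nu> S = (\<Prod>t\<in>S. sigma \<Omega> \<nu> t)"

text \<open>
  \<open>E\<^sub>J f\<close> is the conditional expectation of \<open>f\<close> given the coordinates outside \<open>J\<close>: by independence,
  the coordinates in \<open>J\<close> are redrawn from their product measure and the others are kept.
\<close>

definition avg :: "(nat \<Rightarrow> 'a pmf) \<Rightarrow> nat set \<Rightarrow> ((nat \<Rightarrow> 'a) \<Rightarrow> real) \<Rightarrow> (nat \<Rightarrow> 'a) \<Rightarrow> real" where
  "avg \<nu> J f \<omega> = measure_pmf.expectation (Pi_pmf J undefined \<nu>) (\<lambda>y. f (override_on \<omega> y J))"

definition efron_stein ::
  "nat \<Rightarrow> (nat \<Rightarrow> 'a pmf) \<Rightarrow> nat set \<Rightarrow> ((nat \<Rightarrow> 'a) \<Rightarrow> real) \<Rightarrow> (nat \<Rightarrow> 'a) \<Rightarrow> real" where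
  "efron_stein n \<nu> S f \<omega> = (\<Sum>J\<in>Pow S. (-1) ^ card (S - J) * avg \<nu> ({1..n} - J) f \<omega>)"

definition noise ::
  "nat \<Rightarrow> (nat \<Rightarrow> 'a pmf) \<Rightarrow> real \<Rightarrow> ((nat \<Rightarrow> 'a) \<Rightarrow> real) \<Rightarrow> (nat \<Rightarrow> 'a) \<Rightarrow> real" where
  "noise n \<nu> \<rho> f \<omega> = (\<Sum>S\<in>Pow {1..n}. \<rho> ^ card S * efron_stein n \<nu> S f \<omega>)"

definition laplacian ::
  "(nat \<Rightarrow> 'a pmf) \<Rightarrow> nat \<Rightarrow> ((nat \<Rightarrow> 'a) \<Rightarrow> real) \<Rightarrow> (nat \<Rightarrow> 'a) \<Rightarrow> real" where
  "laplacian \<nu> t f \<omega> = f \<omega> - avg \<nu> {t} f \<omega>"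

text \<open>
  The operators \<open>laplacian \<nu> t\<close> commute when the factors are finite, so composing them in
  increasing order of \<open>t\<close> is no restriction.
\<close>

definition laplacian_set ::
  "(nat \<Rightarrow> 'a pmf) \<Rightarrow> nat set \<Rightarrow> ((nat \<Rightarrow> 'a) \<Rightarrow> real) \<Rightarrow> (nat \<Rightarrow> 'a) \<Rightarrow> real" where
  "laplacian_set \<nu> S f = foldr (laplacian \<nu>) (sorted_list_of_set S) f"

end

theory Submission
  imports Defs
begin

text \<open>
  Write \<open>q = 2m\<close>. The bound is proved one coordinate at a time, for the stronger quantity
  \<open>E\<^sub>I ((E\<^sub>K ((T\<^sub>I f)\<^sup>2))\<^sup>m)\<close>, where \<open>T\<^sub>I\<close> is the noise on \<open>I\<close> and \<open>K\<close> is disjoint from \<open>I\<close>. Adding a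
  coordinate \<open>t\<close> to \<open>I\<close>, one has \<open>T f = a + \<rho> b\<close> with \<open>a = T\<^sub>I E\<^sub>t f\<close> independent of \<open>t\<close> and
  \<open>b = T\<^sub>I L\<^sub>t f\<close> of mean zero in \<open>t\<close>. The \<open>m\<close>-th power of \<open>E\<^sub>K ((a + \<rho> b)\<^sup>2)\<close> is expanded around
  \<open>P = E\<^sub>K (a\<^sup>2)\<close>: the linear term in \<open>b\<close> averages to zero, the quadratic term combines with \<open>P\<^sup>m\<close> into
  \<open>(E\<^sub>t E\<^sub>K ((T\<^sub>I f)\<^sup>2))\<^sup>m\<close>, to which the induction hypothesis applies with \<open>t\<close> moved into \<open>K\<close>, and the
  top term \<open>(E\<^sub>K (b\<^sup>2))\<^sup>m\<close> is handled by the induction hypothesis for \<open>L\<^sub>t f\<close>, at the price of a factor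
  \<open>\<sigma>\<^sub>t powr (2 - q)\<close> for pulling the \<open>m\<close>-th power out of \<open>E\<^sub>t\<close>.
\<close>

section \<open>A scalar inequality\<close>

text \<open>For \<open>x = - y\<close> negative this inverts
  \<open>exp y \<ge> 1 + y + y\<^sup>2 / 2\<close>: the product of that polynomial with
  \<open>1 - y + y\<^sup>2\<close> is at least 1.\<close>

lemma exp_le_quadratic:
  fixes x :: real
  assumes "\<bar>x\<bar> \<le> 1"
  shows "exp x \<le> 1 + x + x\<^sup>2"
proof (cases "0 \<le> x")
  case True
  then show ?thesis using exp_bound[of x] assms by simp
next
  case False
  define y where "y = - x"
  have y: "0 \<le> y" "y \<le> 1" using False assms by (auto simp: y_def)
  have "(1 + y + y\<^sup>2 / 2) * (1 - y + y\<^sup>2) = 1 + (y^2 + y^3 + y^4) / 2"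
    by (simp add: field_simps power_def eval_nat_numeral)
  also have "\<dots> \<ge> 1" using y by simp
  finally have "1 \<le> (1 + y + y\<^sup>2 / 2) * (1 - y + y\<^sup>2)" .
  also have "\<dots> \<le> exp y * (1 - y + y\<^sup>2)"
    using exp_lower_Taylor_quadratic[OF y(1)] y by (intro mult_right_mono) auto
  finally have "exp x * 1 \<le> exp x * (exp y * (1 - y + y\<^sup>2))"
    by (intro mult_left_mono) auto
  then show ?thesis by (simp add: y_def mult.assoc[symmetric] exp_minus)
qed

text \<open>This is the case \<open>P = 1\<close>, \<open>Q = g\<^sup>2\<close> of
  \<open>power_perturb_ineq\<close>. If \<open>m * r * g\<close> is small, comparison with
  \<open>exp\<close> leaves an error that fits into \<open>m * g\<^sup>2\<close>; otherwise
  \<open>g\<close> is large and \<open>g ^ (2 * m)\<close> dominates.\<close>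

lemma normalized_power_ineq:
  fixes c g r :: real
  assumes "\<bar>c\<bar> \<le> g" "0 \<le> r" "16 * real m * r \<le> 1" "1 \<le> m"
  shows "(1 + 2*r*c + r\<^sup>2*g\<^sup>2)^m \<le> 1 + 2*real m*r*c + real m*g\<^sup>2 + g^(2*m)"
proof -
  define u where "u = 2*r*c + r\<^sup>2*g\<^sup>2"
  have g0: "0 \<le> g" using assms(1) by linarith
  have m1: "1 \<le> real m" using assms(4) by simp
  have r16: "16 * r \<le> 1"
    using mult_right_mono[OF m1, of "16*r"] assms(2,3) by (simp add: mult_ac)
  have rc: "\<bar>r*c\<bar> \<le> r*g"
    using assms(1,2) by (simp add: abs_mult mult_left_mono)
  have rg0: "0 \<le> r*g" using assms(2) g0 by simp
  show ?thesis
  \<comment> \<open>Since \<open>\<bar>u\<bar> \<le> 3 * (r * g)\<close> below, this threshold gives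
    \<open>\<bar>m * u\<bar> \<le> 1\<close>, the range of \<open>exp_le_quadratic\<close>.\<close>
  proof (cases "3 * real m * (r*g) \<le> 1")
    case True
    have rg: "r*g \<le> 1"
      using mult_right_mono[OF m1, of "r*g"] True rg0 by linarith
    have "(r*g)*(r*g) \<le> r*g*1" using rg rg0 by (intro mult_left_mono) auto
    then have u: "\<bar>u\<bar> \<le> 3*(r*g)"
    proof -
      have "u = 2*(r*c) + (r*g)*(r*g)" by (simp add: u_def power2_eq_square)
      moreover have "0 \<le> (r*g)*(r*g)" by simp
      ultimately show ?thesis using rc \<open>(r*g)*(r*g) \<le> r*g*1\<close> by linarith
    qed
    have "real m * \<bar>u\<bar> \<le> real m * (3*(r*g))" using u by (intro mult_left_mono) auto
    then have mu: "\<bar>real m * u\<bar> \<le> 1" and mu3: "\<bar>real m * u\<bar> \<le> 3 * real m * (r*g)"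
      using True by (auto simp: abs_mult mult_ac)
    have "\<bar>u\<bar> \<le> 1" using mult_right_mono[OF m1, of "\<bar>u\<bar>"] mu by (simp add: abs_mult)
    then have "(1+u)^m \<le> exp u ^ m" by (intro power_mono) auto
    also have "\<dots> = exp (real m * u)" by (simp add: exp_of_nat_mult)
    also have "\<dots> \<le> 1 + real m * u + (real m * u)\<^sup>2" by (rule exp_le_quadratic[OF mu])
    also have "(real m * u)\<^sup>2 \<le> (3 * real m * (r*g))\<^sup>2"
      using mu3 by (metis abs_ge_zero power2_abs power_mono)
    \<comment> \<open>As \<open>m * r\<close> and \<open>r\<close> are at most 1/16, the quadratic
      error costs 9/256 of \<open>m * g\<^sup>2\<close>, and the
      \<open>r\<^sup>2 * g\<^sup>2\<close> part of \<open>u\<close> another 1/256.\<close>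
    also have "(3 * real m * (r*g))\<^sup>2 = real m * g\<^sup>2 * (9 * (real m * r * r))"
      by (simp add: power2_eq_square)
    also have "\<dots> \<le> real m * g\<^sup>2 * (9 * (1/256))"
    proof -
      have "(real m * r) * r \<le> (1/16) * (1/16)"
        using r16 assms(2,3) by (intro mult_mono) auto
      then show ?thesis by (intro mult_left_mono) auto
    qed
    also have "real m * u = 2*real m*r*c + real m * g\<^sup>2 * (r*r)"
      by (simp add: u_def algebra_simps power2_eq_square)
    also have "real m * g\<^sup>2 * (r*r) \<le> real m * g\<^sup>2 * (1/256)"
    proof -
      have "r * r \<le> (1/16) * (1/16)"
        using r16 assms(2) by (intro mult_mono) auto
      then show ?thesis by (intro mult_left_mono) auto
    qed
    finally have "(1+u)^m \<le> 1 + 2*real m*r*c + real m * g\<^sup>2 * (10/256)"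
      by simp
    also have "real m * g\<^sup>2 * (10/256) \<le> real m * g\<^sup>2 * 1" by (intro mult_left_mono) auto
    finally have "(1+u)^m \<le> 1 + 2*real m*r*c + real m * g\<^sup>2" by simp
    moreover have "0 \<le> g^(2*m)" using g0 by simp
    ultimately show ?thesis by (simp only: u_def add.assoc)
  next
    case False
    \<comment> \<open>Here \<open>m * r * g\<close> exceeds 1/3 but is at most
      \<open>g / 16\<close>, hence \<open>g \<ge> 16 / 3\<close>.\<close>
    have "(16 * real m * r) * g \<le> 1 * g" using assms(3) g0 by (intro mult_right_mono)
    moreover have "(16 * real m * r) * g = 16 * (real m * (r*g))" by simp
    moreover have "1 < 3 * (real m * (r*g))" using False by (simp only: mult.assoc not_le)
    ultimately have g: "16 \<le> 3 * g" by linarith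
    have rg: "16 * r * g \<le> 1 * g" using r16 g0 by (intro mult_right_mono)
    \<comment> \<open>Comparing powers requires a nonnegative base; it is at least
      \<open>(1 + r * c)\<^sup>2\<close>.\<close>
    have sq: "r\<^sup>2 * c\<^sup>2 \<le> r\<^sup>2 * g\<^sup>2"
      using power_mono[OF assms(1), of 2] by (intro mult_left_mono) auto
    have "0 \<le> (1 + r*c)\<^sup>2" by simp
    then have "0 \<le> 1 + 2*r*c + r\<^sup>2*g\<^sup>2" using sq by (simp add: power2_eq_square algebra_simps)
    moreover have "1 + 2*r*c + r\<^sup>2*g\<^sup>2 \<le> (1 + r*g)\<^sup>2"
      using rc by (simp add: power2_eq_square algebra_simps)
    ultimately have "(1 + 2*r*c + r\<^sup>2*g\<^sup>2)^m \<le> ((1 + r*g)\<^sup>2)^m" by (intro power_mono) auto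
    also have "\<dots> = (1 + r*g)^(2*m)" by (simp add: power_mult)
    also have "\<dots> \<le> g^(2*m)"
    proof (rule power_mono)
      have "16 * (r*g) \<le> g" using rg by simp
      then show "1 + r*g \<le> g" using g by linarith
    qed (use rg0 in simp)
    also have "\<dots> \<le> 1 + 2*real m*r*c + real m*g\<^sup>2 + g^(2*m)"
    proof -
      have "- (r*c) \<le> g"
      proof -
        have "16 * (r*g) \<le> g" using rg by simp
        then show ?thesis using rc rg0 by linarith
      qed
      moreover have "2 * g \<le> g * g" using g by (intro mult_right_mono) auto
      ultimately have "0 \<le> 2*(r*c) + g\<^sup>2" unfolding power2_eq_square by linarith
      then have "0 \<le> real m * (2*(r*c) + g\<^sup>2)" by simp
      then show ?thesis by (simp add: algebra_simps)
    qed
    finally show ?thesis .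
  qed
qed

text \<open>Both sides are homogeneous, so dividing by \<open>P ^ m\<close> suffices;
  \<open>P = 0\<close> forces \<open>c = 0\<close>. The term linear in \<open>c\<close> stays exact
  because it will average to zero, and the factor \<open>m\<close> of \<open>P ^ (m - 1) * Q\<close>
  is the one that \<open>power_add_ge_linear\<close> absorbs.\<close>

lemma power_perturb_ineq:
  fixes P Q c r :: real
  assumes "0 \<le> P" "0 \<le> Q" "c\<^sup>2 \<le> P * Q" "0 \<le> r" "16 * real m * r \<le> 1" "1 \<le> m"
  shows "(P + 2*r*c + r\<^sup>2*Q)^m
    \<le> P^m + 2*real m*r*(P^(m-1)*c) + real m*(P^(m-1)*Q) + Q^m"
proof (cases "P = 0")
  case True
  have "16 * r \<le> 1"
    using mult_right_mono[of 1 "real m" "16*r"] assms(4-6) by (simp add: mult_ac)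
  then have "r\<^sup>2 * Q \<le> 1 * Q"
    using assms by (intro mult_right_mono) (auto simp: power_le_one)
  moreover have "c = 0" using assms(3) True by simp
  ultimately have "(P + 2*r*c + r\<^sup>2*Q)^m \<le> Q^m"
    using True assms(2) by (intro power_mono) auto
  moreover have "0 \<le> P^m" "0 \<le> real m*(P^(m-1)*Q)" using assms(1,2) by simp_all
  ultimately show ?thesis using \<open>c = 0\<close> by simp
next
  case False
  then have P: "0 < P" using assms(1) by simp
  define g where "g = sqrt (Q / P)"
  have g2: "g\<^sup>2 = Q / P" using P assms(2) by (simp add: g_def)
  have "(c/P)\<^sup>2 \<le> g\<^sup>2" using P assms(3) unfolding g2
    by (simp add: power2_eq_square field_simps)
  moreover have "0 \<le> g" using P assms(2) by (simp add: g_def)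
  ultimately have "\<bar>c/P\<bar> \<le> g" by (simp only: abs_le_square_iff[symmetric] abs_of_nonneg)
  from normalized_power_ineq[OF this assms(4-6)]
  have "P^m * (1 + 2*r*(c/P) + r\<^sup>2*g\<^sup>2)^m \<le> P^m * (1 + 2*real m*r*(c/P) + real m*g\<^sup>2 + g^(2*m))"
    using P by (intro mult_left_mono) auto
  also have "P^m * (1 + 2*r*(c/P) + r\<^sup>2*g\<^sup>2)^m = (P + 2*r*c + r\<^sup>2*Q)^m"
  proof -
    have "P * (1 + 2*r*(c/P) + r\<^sup>2*(Q/P)) = P + 2*r*c + r\<^sup>2*Q" using P by (simp add: field_simps)
    then show ?thesis by (simp only: power_mult_distrib[symmetric] g2)
  qed
  also have "P^m * (1 + 2*real m*r*(c/P) + real m*g\<^sup>2 + g^(2*m))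
     = P^m + 2*real m*r*(P^(m-1)*c) + real m*(P^(m-1)*Q) + Q^m"
  proof -
    have "P^m = P * P^(m-1)" using assms(6) by (simp add: power_eq_if)
    then show ?thesis unfolding power_mult g2 using P by (simp add: field_simps)
  qed
  finally show ?thesis .
qed

text \<open>The left side consists of the two leading binomial terms, and the omitted ones are
  nonnegative.\<close>

lemma power_add_ge_linear:
  fixes P R :: real
  assumes "0 \<le> P" "0 \<le> R"
  shows "P^m + real m * (P^(m-1)*R) \<le> (P+R)^m"
proof (induction m)
  case (Suc m)
  have "P ^ Suc m + real (Suc m) * (P^m * R) \<le> (P+R) * (P^m + real m * (P^(m-1)*R))"
  proof (cases m)
    case (Suc k)
    then show ?thesis using assms by (simp add: algebra_simps)
  qed (simp)
  also have "\<dots> \<le> (P+R) * (P+R)^m" using Suc assms by (intro mult_left_mono) auto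
  finally show ?case by simp
qed simp

section \<open>Averaging operators\<close>

text \<open>Required at every point rather than on the support, so that such functions leave
  \<open>avg \<nu> {t}\<close> as factors by rewriting.\<close>

definition indep_of :: "nat \<Rightarrow> ((nat \<Rightarrow> 'a) \<Rightarrow> real) \<Rightarrow> bool" where
  "indep_of t g \<longleftrightarrow> (\<forall>w x. g (w(t := x)) = g w)"

lemma avg_empty [simp]: "avg \<nu> {} f = f"
  by (rule ext) (simp add: avg_def)

text \<open>Finite supports make every real function integrable, so the averages are linear without
  side conditions.\<close>

locale finite_factors =
  fixes \<nu> :: "nat \<Rightarrow> 'a pmf" and N :: "nat set"
  assumes finite_index: "finite N"
    and finite_support: "t \<in> N \<Longrightarrow> finite (set_pmf (\<nu> t))"
begin

lemma integrable_factor: "J \<subseteq> N \<Longrightarrow> integrable (measure_pmf (Pi_pmf J undefined \<nu>)) (h :: _ \<Rightarrow> real)"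
  by (rule integrable_measure_pmf_finite)
    (use finite_index finite_support in \<open>auto simp: set_Pi_pmf finite_subset intro!: finite_PiE_dflt\<close>)

lemma avg_singleton: "avg \<nu> {t} f w = measure_pmf.expectation (\<nu> t) (\<lambda>x. f (w(t := x)))"
proof -
  have "override_on w (\<lambda>_. x) {t} = w(t := x)" for x :: 'a
    by (auto simp: override_on_def)
  moreover have "override_on w (\<lambda>a. if a = t then x else undefined) {t} = w(t := x)" for x :: 'a
    by (auto simp: override_on_def)
  ultimately show ?thesis by (simp add: avg_def Pi_pmf_singleton)
qed

text \<open>Fubini for the coordinate \<open>t\<close> against the block \<open>J\<close>, in both
  orders; with finite supports it is an exchange of finite sums.\<close>

lemma avg_insert:
  assumes "insert t J \<subseteq> N" "t \<notin> J"
  shows "avg \<nu> (insert t J) f = avg \<nu> {t} (avg \<nu> J f)"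
    and "avg \<nu> (insert t J) f = avg \<nu> J (avg \<nu> {t} f)"
proof -
  have fJ: "finite J" using assms finite_index finite_subset by auto
  let ?P = "Pi_pmf J undefined \<nu>"
  have fp: "finite (set_pmf ?P)" "finite (set_pmf (\<nu> t))"
    using assms finite_support fJ by (auto simp: set_Pi_pmf intro!: finite_PiE_dflt)
  have ov: "override_on w (y(t := x)) (insert t J) = override_on (w(t := x)) y J"
    for w y :: "nat \<Rightarrow> 'a" and x using assms(2) by (auto simp: override_on_def)
  have ov2: "override_on (w(t := x)) y J = (override_on w y J)(t := x)"
    for w y :: "nat \<Rightarrow> 'a" and x using assms(2) by (auto simp: override_on_def)
  have eq: "avg \<nu> (insert t J) f w = measure_pmf.expectation (pair_pmf (\<nu> t) ?P)
      (\<lambda>(x,y). f (override_on (w(t := x)) y J))" for w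
    unfolding avg_def Pi_pmf_insert[OF fJ assms(2)]
    by (simp add: case_prod_unfold ov)
  have iter: "measure_pmf.expectation (pair_pmf (\<nu> t) ?P) (\<lambda>(x,y). h x y) =
    measure_pmf.expectation (\<nu> t) (\<lambda>x. measure_pmf.expectation ?P (h x))" for h :: "_ \<Rightarrow> _ \<Rightarrow> real"
  proof -
    have "measure_pmf.expectation (pair_pmf (\<nu> t) ?P) (\<lambda>(x,y). h x y) =
      (\<Sum>(x,y)\<in>set_pmf (\<nu> t) \<times> set_pmf ?P. h x y * pmf (pair_pmf (\<nu> t) ?P) (x,y))"
      using fp by (subst integral_measure_pmf_real[where A="set_pmf (\<nu> t) \<times> set_pmf ?P"])
        (auto simp: case_prod_unfold)
    also have "\<dots> = measure_pmf.expectation (\<nu> t) (\<lambda>x. measure_pmf.expectation ?P (h x))"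
      using fp by (simp add: integral_measure_pmf_real[where A="set_pmf (\<nu> t)"]
          integral_measure_pmf_real[where A="set_pmf ?P"] pmf_pair sum.cartesian_product[symmetric]
          sum_distrib_right sum_distrib_left mult_ac)
    finally show ?thesis .
  qed
  have iter2: "measure_pmf.expectation (pair_pmf (\<nu> t) ?P) (\<lambda>(x,y). h x y) =
    measure_pmf.expectation ?P (\<lambda>y. measure_pmf.expectation (\<nu> t) (\<lambda>x. h x y))" for h :: "_ \<Rightarrow> _ \<Rightarrow> real"
    unfolding iter using fp
    by (simp add: integral_measure_pmf_real[where A="set_pmf (\<nu> t)"] sum_distrib_right integrable_measure_pmf_finite)
  show "avg \<nu> (insert t J) f = avg \<nu> {t} (avg \<nu> J f)"
    by (rule ext) (simp add: eq iter avg_singleton, simp add: avg_def)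
  show "avg \<nu> (insert t J) f = avg \<nu> J (avg \<nu> {t} f)"
    by (rule ext) (simp add: eq iter2 avg_def[of _ J] avg_singleton ov2)
qed

lemma avg_commute:
  assumes "insert t J \<subseteq> N" "t \<notin> J"
  shows "avg \<nu> J (avg \<nu> {t} f) = avg \<nu> {t} (avg \<nu> J f)"
  using avg_insert[OF assms, of f] by simp

lemma avg_add: "J \<subseteq> N \<Longrightarrow> avg \<nu> J (\<lambda>w. f w + g w) w = avg \<nu> J f w + avg \<nu> J g w"
  by (simp add: avg_def integrable_factor)

lemma avg_diff: "J \<subseteq> N \<Longrightarrow> avg \<nu> J (\<lambda>w. f w - g w) w = avg \<nu> J f w - avg \<nu> J g w"
  by (simp add: avg_def integrable_factor)

lemma avg_cmult: "avg \<nu> J (\<lambda>w. c * f w) w = c * avg \<nu> J f w"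
  by (simp add: avg_def)

lemma avg_const [simp]: "avg \<nu> J (\<lambda>w. c) w = c"
  by (simp add: avg_def)

lemma avg_sum: "J \<subseteq> N \<Longrightarrow> avg \<nu> J (\<lambda>w. \<Sum>i\<in>A. f i w) w = (\<Sum>i\<in>A. avg \<nu> J (f i) w)"
  by (simp add: avg_def integrable_factor)

lemma avg_mono: "J \<subseteq> N \<Longrightarrow> (\<And>w. f w \<le> g w) \<Longrightarrow> avg \<nu> J f w \<le> avg \<nu> J g w"
  by (simp add: avg_def integrable_factor integral_mono)

lemma avg_nonneg: "(\<And>w. 0 \<le> f w) \<Longrightarrow> 0 \<le> avg \<nu> J f w"
  by (simp add: avg_def)

lemma indep_of_avg:
  assumes "indep_of t f"
  shows "indep_of t (avg \<nu> J f)"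
proof -
  have "f (override_on (w(t := x)) y J) = f (override_on w y J)" for w x y
  proof (cases "t \<in> J")
    case True
    then have "override_on (w(t := x)) y J = override_on w y J" by (auto simp: override_on_def)
    then show ?thesis by simp
  next
    case False
    then have "override_on (w(t := x)) y J = (override_on w y J)(t := x)"
      by (auto simp: override_on_def)
    then show ?thesis using assms by (simp add: indep_of_def)
  qed
  then show ?thesis by (simp add: indep_of_def avg_def)
qed

lemma indep_of_avg_singleton: "indep_of t (avg \<nu> {t} f)"
  by (simp add: indep_of_def avg_singleton)

lemma avg_indep_mult: "indep_of t g \<Longrightarrow> avg \<nu> {t} (\<lambda>w. g w * f w) w = g w * avg \<nu> {t} f w"
  by (simp add: avg_singleton indep_of_def)

lemma avg_indep: "indep_of t g \<Longrightarrow> avg \<nu> {t} g w = g w"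
  by (simp add: avg_singleton indep_of_def)

text \<open>\<open>E\<^sub>t\<close> is idempotent, since its values no longer depend on coordinate
  \<open>t\<close>.\<close>

lemma avg_laplacian: "t \<in> N \<Longrightarrow> avg \<nu> {t} (laplacian \<nu> t f) w = 0"
  unfolding laplacian_def by (simp add: avg_diff avg_indep[OF indep_of_avg_singleton])

lemma avg_Cauchy_Schwarz:
  assumes "J \<subseteq> N"
  shows "(avg \<nu> J (\<lambda>w. f w * g w) w)\<^sup>2 \<le> avg \<nu> J (\<lambda>w. (f w)\<^sup>2) w * avg \<nu> J (\<lambda>w. (g w)\<^sup>2) w"
proof -
  let ?P = "Pi_pmf J undefined \<nu>"
  have "finite (set_pmf ?P)"
    using assms finite_index finite_support
    by (auto simp: set_Pi_pmf finite_subset intro!: finite_PiE_dflt)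
  then have *: "avg \<nu> J h w = (\<Sum>y\<in>set_pmf ?P. pmf ?P y * h (override_on w y J))" for h
    by (simp add: avg_def integral_measure_pmf_real[where A="set_pmf ?P"] mult_ac)
  \<comment> \<open>Splitting each weight into two square roots reduces the claim to the inequality
    for finite sums.\<close>
  let ?s = "\<lambda>y. sqrt (pmf ?P y)" and ?o = "\<lambda>y. override_on w y J"
  have "(\<Sum>y\<in>set_pmf ?P. (?s y * f (?o y)) * (?s y * g (?o y)))\<^sup>2 \<le>
    (\<Sum>y\<in>set_pmf ?P. (?s y * f (?o y))\<^sup>2) * (\<Sum>y\<in>set_pmf ?P. (?s y * g (?o y))\<^sup>2)"
    by (rule Cauchy_Schwarz_ineq_sum)
  also have "(\<Sum>y\<in>set_pmf ?P. (?s y * f (?o y)) * (?s y * g (?o y))) = avg \<nu> J (\<lambda>w. f w * g w) w"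
  proof -
    have "(?s y * u) * (?s y * v) = pmf ?P y * (u * v)" for y u v
    proof -
      have "(?s y * u) * (?s y * v) = (?s y * ?s y) * (u * v)" by (simp only: mult_ac)
      then show ?thesis by simp
    qed
    then show ?thesis by (simp only: *)
  qed
  finally show ?thesis by (simp add: * power_mult_distrib)
qed

section \<open>The noise operator on a set of coordinates\<close>

text \<open>The noise acts on the coordinates in \<open>I\<close> only, the others being parameters;
  \<open>I = {1..n}\<close> gives \<open>noise\<close>.\<close>

definition noise_on :: "real \<Rightarrow> nat set \<Rightarrow> ((nat \<Rightarrow> 'a) \<Rightarrow> real) \<Rightarrow> (nat \<Rightarrow> 'a) \<Rightarrow> real" where
  "noise_on \<rho> I f w =
    (\<Sum>S\<in>Pow I. \<rho> ^ card S * (\<Sum>J\<in>Pow S. (-1) ^ card (S - J) * avg \<nu> (I - J) f w))"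

lemma noise_on_empty [simp]: "noise_on \<rho> {} f = f"
  by (rule ext) (simp add: noise_on_def)

lemma noise_on_add: "I \<subseteq> N \<Longrightarrow> noise_on \<rho> I (\<lambda>w. f w + g w) w = noise_on \<rho> I f w + noise_on \<rho> I g w"
  by (simp add: noise_on_def avg_add Diff_subset[THEN subset_trans] algebra_simps sum.distrib sum_distrib_left)

lemma indep_of_noise_on: "indep_of t f \<Longrightarrow> indep_of t (noise_on \<rho> I f)"
  using indep_of_avg[of t f] by (simp add: indep_of_def noise_on_def)

lemma avg_noise_on:
  assumes "insert t I \<subseteq> N" "t \<notin> I"
  shows "avg \<nu> {t} (noise_on \<rho> I f) w = noise_on \<rho> I (avg \<nu> {t} f) w"
proof -
  have "avg \<nu> {t} (avg \<nu> (I - J) f) = avg \<nu> (I - J) (avg \<nu> {t} f)" for J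
    using assms by (intro avg_commute[symmetric]) auto
  then show ?thesis using assms unfolding noise_on_def[abs_def] by (simp add: avg_sum avg_cmult)
qed

lemma sum_Pow_insert:
  fixes h :: "'b set \<Rightarrow> real"
  assumes "finite I" "t \<notin> I"
  shows "(\<Sum>S\<in>Pow (insert t I). h S) = (\<Sum>S\<in>Pow I. h S) + (\<Sum>S\<in>Pow I. h (insert t S))"
proof -
  have "inj_on (insert t) (Pow I)" using assms(2) by (auto simp: inj_on_def)
  moreover have "Pow I \<inter> insert t ` Pow I = {}" using assms(2) by auto
  ultimately show ?thesis using assms(1) by (simp add: Pow_insert sum.union_disjoint sum.reindex)
qed

text \<open>The noise on one coordinate is \<open>E\<^sub>t + \<rho> L\<^sub>t\<close>. Sets
  \<open>S\<close> without \<open>t\<close> yield the \<open>E\<^sub>t\<close> part, sets containing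
  \<open>t\<close> the \<open>L\<^sub>t\<close> part with one extra factor
  \<open>\<rho>\<close>.\<close>

lemma noise_on_insert:
  assumes "insert t I \<subseteq> N" "t \<notin> I"
  shows "noise_on \<rho> (insert t I) f w =
    noise_on \<rho> I (avg \<nu> {t} f) w + \<rho> * noise_on \<rho> I (laplacian \<nu> t f) w"
proof -
  have fI: "finite I" using assms finite_index finite_subset by auto
  have fS: "finite S" if "S \<in> Pow I" for S using that fI finite_subset by auto
  have av: "avg \<nu> (insert t I - J) f = avg \<nu> (I - J) (avg \<nu> {t} f)" if "J \<in> Pow I" for J
  proof -
    have "insert t I - J = insert t (I - J)" using that assms by auto
    moreover have "avg \<nu> (insert t (I - J)) f = avg \<nu> (I - J) (avg \<nu> {t} f)"
      using assms by (intro avg_insert(2)) auto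
    ultimately show ?thesis by simp
  qed
  have 1: "(\<Sum>J\<in>Pow S. (-1) ^ card (S - J) * avg \<nu> (insert t I - J) f w) =
     (\<Sum>J\<in>Pow S. (-1) ^ card (S - J) * avg \<nu> (I - J) (avg \<nu> {t} f) w)" if "S \<in> Pow I" for S
    using that by (intro sum.cong refl) (auto simp: av)
  have 2: "(\<Sum>J\<in>Pow (insert t S). (-1) ^ card (insert t S - J) * avg \<nu> (insert t I - J) f w) =
     (\<Sum>J\<in>Pow S. (-1) ^ card (S - J) * avg \<nu> (I - J) (laplacian \<nu> t f) w)" if S: "S \<in> Pow I" for S
  proof -
    have tS: "t \<notin> S" using S assms by auto
    \<comment> \<open>Sets \<open>J\<close> without \<open>t\<close> average over \<open>t\<close>
      and carry an extra sign; those with \<open>t\<close> (\<open>B\<close>) do not. Their sum is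
      the average of \<open>f - E\<^sub>t f\<close>.\<close>
    have A: "(-1) ^ card (insert t S - J) * avg \<nu> (insert t I - J) f w =
      - ((-1) ^ card (S - J) * avg \<nu> (I - J) (avg \<nu> {t} f) w)" if "J \<in> Pow S" for J
    proof -
      have "insert t S - J = insert t (S - J)" using that tS by auto
      then have "card (insert t S - J) = Suc (card (S - J))" using fS[OF S] tS by simp
      then show ?thesis using av[of J] that S by auto
    qed
    have B: "(-1) ^ card (insert t S - insert t J) * avg \<nu> (insert t I - insert t J) f w =
      (-1) ^ card (S - J) * avg \<nu> (I - J) f w" if "J \<in> Pow S" for J
    proof -
      have "insert t S - insert t J = S - J" "insert t I - insert t J = I - J"
        using that S tS assms by auto
      then show ?thesis by simp
    qed
    have C: "avg \<nu> (I - J) (laplacian \<nu> t f) w = avg \<nu> (I - J) f w - avg \<nu> (I - J) (avg \<nu> {t} f) w" for J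
      unfolding laplacian_def[abs_def] using assms by (intro avg_diff) auto
    show ?thesis
      unfolding sum_Pow_insert[OF fS[OF S] tS] using A B
      by (simp add: C right_diff_distrib sum_subtractf sum_negf)
  qed
  have 3: "card (insert t S) = Suc (card S)" if "S \<in> Pow I" for S
    using fS[OF that] that assms(2) by (intro card_insert_disjoint) auto
  show ?thesis
    unfolding noise_on_def sum_Pow_insert[OF fI assms(2)]
    by (simp add: 1 2 3 sum_distrib_left mult.assoc)
qed

text \<open>\<open>foldr\<close> applies the last list entry first, so the largest index is the
  innermost operator.\<close>

lemma laplacian_set_insert:
  assumes "finite S" "\<And>s. s \<in> S \<Longrightarrow> s < t"
  shows "laplacian_set \<nu> (insert t S) f = laplacian_set \<nu> S (laplacian \<nu> t f)"
proof -
  have "sorted_list_of_set (insert t S) = sorted_list_of_set S @ [t]"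
    using sorted_list_of_set.idem_if_sorted_distinct[of "sorted_list_of_set S @ [t]"] assms
    by (fastforce simp: sorted_wrt_append less_imp_le)
  then show ?thesis by (simp add: laplacian_set_def)
qed

section \<open>Hypercontractivity by induction over the coordinates\<close>

text \<open>\<open>\<tau> t\<close> is the price of pulling an \<open>m\<close>-th power out of
  \<open>E\<^sub>t\<close>. The set \<open>K\<close> and the function \<open>f\<close> vary in the
  induction: the hypothesis is applied to \<open>f\<close> with \<open>insert t K\<close> and to
  \<open>L\<^sub>t f\<close> with \<open>K\<close>.\<close>

lemma noise_on_power_bound:
  fixes \<tau> :: "nat \<Rightarrow> real"
  assumes "I \<subseteq> N" "K \<subseteq> N" "I \<inter> K = {}"
    and "0 \<le> \<rho>" "16 * real m * \<rho> \<le> 1" "1 \<le> m"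
    and \<tau>0: "\<And>t. 0 \<le> \<tau> t"
    and \<tau>: "\<And>t g w. t \<in> N \<Longrightarrow> (\<And>w. 0 \<le> g w) \<Longrightarrow>
      avg \<nu> {t} (\<lambda>w. g w ^ m) w \<le> \<tau> t * avg \<nu> {t} g w ^ m"
  shows "avg \<nu> I (\<lambda>w. avg \<nu> K (\<lambda>w. (noise_on \<rho> I f w)\<^sup>2) w ^ m) w \<le>
    (\<Sum>S\<in>Pow I. (\<Prod>t\<in>S. \<tau> t) * avg \<nu> (I \<union> K) (\<lambda>w. (laplacian_set \<nu> S f w)\<^sup>2) w ^ m)"
proof -
  have "finite I" using assms(1) finite_index finite_subset by auto
  then show ?thesis using assms(1-3)
  \<comment> \<open>The largest coordinate is added last, to match the order of composition in
    \<open>laplacian_set\<close>.\<close>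
  proof (induction I arbitrary: K f w rule: finite_linorder_max_induct)
    case empty
    then show ?case by (simp add: laplacian_set_def)
  next
    case (insert t I)
    have tI: "t \<notin> I" and tN: "t \<in> N" and IN: "I \<subseteq> N" and tK: "t \<notin> K"
      and tIN: "insert t I \<subseteq> N" and tKN: "insert t K \<subseteq> N"
      using insert by auto
    define a where "a = noise_on \<rho> I (avg \<nu> {t} f)"
    define b where "b = noise_on \<rho> I (laplacian \<nu> t f)"
    define P where "P = avg \<nu> K (\<lambda>w. (a w)\<^sup>2)"
    define Q where "Q = avg \<nu> K (\<lambda>w. (b w)\<^sup>2)"
    define c where "c = avg \<nu> K (\<lambda>w. a w * b w)"
    have P0: "0 \<le> P w" and Q0: "0 \<le> Q w" for w by (simp_all add: P_def Q_def avg_nonneg)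
    have ia: "indep_of t a" unfolding a_def by (intro indep_of_noise_on indep_of_avg_singleton)
    then have ia2: "indep_of t (\<lambda>w. (a w)\<^sup>2)" by (simp add: indep_of_def)
    then have iP: "indep_of t P" unfolding P_def by (rule indep_of_avg)
    then have iPk: "indep_of t (\<lambda>w. P w ^ k)" for k by (simp add: indep_of_def)
    have z: "avg \<nu> {t} (laplacian \<nu> t f) = (\<lambda>_. 0)" using avg_laplacian[OF tN] by auto
    have b0: "avg \<nu> {t} b w = 0" for w
      unfolding b_def avg_noise_on[OF tIN tI] z by (simp add: noise_on_def)
    \<comment> \<open>As \<open>t \<notin> K\<close>, the averages commute; \<open>a\<close> ignores
      coordinate \<open>t\<close> and \<open>b\<close> has mean zero in it.\<close>
    have c0: "avg \<nu> {t} c w = 0" for w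
      unfolding c_def avg_commute[OF tKN tK, symmetric]
      by (simp add: avg_indep_mult[OF ia, abs_def] b0)
    have T: "noise_on \<rho> (insert t I) f w = a w + \<rho> * b w" for w
      unfolding a_def b_def by (rule noise_on_insert[OF tIN tI])
    have expand: "avg \<nu> K (\<lambda>w. (noise_on \<rho> (insert t I) f w)\<^sup>2) w = P w + 2*\<rho>*c w + \<rho>\<^sup>2*Q w" for w
    proof -
      have "(\<lambda>w. (noise_on \<rho> (insert t I) f w)\<^sup>2) = (\<lambda>w. (a w)\<^sup>2 + (2*\<rho>*(a w * b w) + \<rho>\<^sup>2*(b w)\<^sup>2))"
        by (rule ext) (simp add: T power2_eq_square algebra_simps)
      then show ?thesis using insert.prems(2) by (simp add: avg_add avg_cmult P_def Q_def c_def)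
    qed
    have fab: "f = (\<lambda>w. avg \<nu> {t} f w + laplacian \<nu> t f w)" by (simp add: laplacian_def)
    have Tf: "noise_on \<rho> I f w = a w + b w" for w
      unfolding a_def b_def by (subst fab, rule noise_on_add[OF IN])
    \<comment> \<open>Without noise on \<open>t\<close> the function is \<open>a + b\<close>, and
      its cross term vanishes under \<open>E\<^sub>t\<close>. This is the quantity of the induction
      hypothesis with \<open>t\<close> moved into \<open>K\<close>.\<close>
    have PQ: "P w + avg \<nu> {t} Q w = avg \<nu> (insert t K) (\<lambda>w. (noise_on \<rho> I f w)\<^sup>2) w" for w
    proof -
      have "(\<lambda>w. (noise_on \<rho> I f w)\<^sup>2) = (\<lambda>w. (a w)\<^sup>2 + (2*(a w * b w) + (b w)\<^sup>2))"
        by (rule ext) (simp add: Tf power2_eq_square algebra_simps)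
      then have "avg \<nu> K (\<lambda>w. (noise_on \<rho> I f w)\<^sup>2) = (\<lambda>w. P w + (2 * c w + Q w))"
        using insert.prems(2) by (simp add: avg_add avg_cmult P_def Q_def c_def fun_eq_iff)
      then show ?thesis
        using tN by (simp add: avg_insert(1)[OF tKN tK] avg_add avg_cmult c0 avg_indep[OF iP])
    qed
    have pt: "(P w + 2*\<rho>*c w + \<rho>\<^sup>2*Q w)^m \<le>
      P w^m + (2*real m*\<rho>*(P w^(m-1)*c w) + (real m*(P w^(m-1)*Q w) + Q w^m))" for w
    proof -
      have "(c w)\<^sup>2 \<le> P w * Q w"
        unfolding P_def Q_def c_def by (rule avg_Cauchy_Schwarz[OF insert.prems(2)])
      from power_perturb_ineq[OF P0 Q0 this assms(4-6)] show ?thesis by (simp add: add.assoc)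
    qed
    have one: "avg \<nu> {t} (\<lambda>w. (P w + 2*\<rho>*c w + \<rho>\<^sup>2*Q w)^m) w \<le>
      avg \<nu> (insert t K) (\<lambda>w. (noise_on \<rho> I f w)\<^sup>2) w ^ m + avg \<nu> {t} (\<lambda>w. Q w ^ m) w" for w
    proof -
      have "avg \<nu> {t} (\<lambda>w. (P w + 2*\<rho>*c w + \<rho>\<^sup>2*Q w)^m) w \<le>
        avg \<nu> {t} (\<lambda>w. P w^m + (2*real m*\<rho>*(P w^(m-1)*c w) + (real m*(P w^(m-1)*Q w) + Q w^m))) w"
        using pt tN by (intro avg_mono) auto
      also have "\<dots> = P w^m + real m * (P w^(m-1) * avg \<nu> {t} Q w) + avg \<nu> {t} (\<lambda>w. Q w ^ m) w"
        using tN by (simp add: avg_add avg_cmult avg_indep_mult[OF iPk] avg_indep[OF iPk] c0)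
      also have "P w^m + real m * (P w^(m-1) * avg \<nu> {t} Q w) \<le> (P w + avg \<nu> {t} Q w)^m"
        by (intro power_add_ge_linear P0 avg_nonneg Q0)
      finally show ?thesis by (simp add: PQ)
    qed
    let ?L = "\<lambda>S. \<lambda>w. (laplacian_set \<nu> S f w)\<^sup>2"
    have U: "insert t I \<union> K = insert t (I \<union> K)" by auto
    have UN: "insert t (I \<union> K) \<subseteq> N" and tU: "t \<notin> I \<union> K" using tIN tKN tI tK by auto
    have "avg \<nu> (insert t I) (\<lambda>w. avg \<nu> K (\<lambda>w. (noise_on \<rho> (insert t I) f w)\<^sup>2) w ^ m) w
       = avg \<nu> I (avg \<nu> {t} (\<lambda>w. (P w + 2*\<rho>*c w + \<rho>\<^sup>2*Q w)^m)) w"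
      by (simp add: expand avg_insert(2)[OF tIN tI])
    also have "\<dots> \<le> avg \<nu> I (\<lambda>w. avg \<nu> (insert t K) (\<lambda>w. (noise_on \<rho> I f w)\<^sup>2) w ^ m
        + avg \<nu> {t} (\<lambda>w. Q w ^ m) w) w"
      by (intro avg_mono[OF IN] one)
    \<comment> \<open>In the second summand \<open>E\<^sub>t\<close> is moved outside, so that the
      induction hypothesis applies under it.\<close>
    also have "\<dots> = avg \<nu> I (\<lambda>w. avg \<nu> (insert t K) (\<lambda>w. (noise_on \<rho> I f w)\<^sup>2) w ^ m) w
       + avg \<nu> {t} (avg \<nu> I (\<lambda>w. Q w ^ m)) w"
      using avg_commute[OF tIN tI, of "\<lambda>w. Q w ^ m"] by (simp add: avg_add[OF IN])
    \<comment> \<open>This summand yields the sets \<open>S\<close> without \<open>t\<close>; the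
      next one yields those containing \<open>t\<close>.\<close>
    also have "avg \<nu> I (\<lambda>w. avg \<nu> (insert t K) (\<lambda>w. (noise_on \<rho> I f w)\<^sup>2) w ^ m) w \<le>
      (\<Sum>S\<in>Pow I. (\<Prod>t\<in>S. \<tau> t) * avg \<nu> (insert t I \<union> K) (?L S) w ^ m)"
      using insert.IH[OF IN tKN] tI insert.prems(3) by simp
    also have "avg \<nu> {t} (avg \<nu> I (\<lambda>w. Q w ^ m)) w \<le> avg \<nu> {t} (\<lambda>w. \<Sum>S\<in>Pow I. (\<Prod>t\<in>S. \<tau> t) *
        avg \<nu> (I \<union> K) (\<lambda>w. (laplacian_set \<nu> S (laplacian \<nu> t f) w)\<^sup>2) w ^ m) w"
      unfolding Q_def b_def using tN insert.prems by (intro avg_mono insert.IH) auto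
    also have "\<dots> = (\<Sum>S\<in>Pow I. (\<Prod>t\<in>S. \<tau> t) * avg \<nu> {t} (\<lambda>w. avg \<nu> (I \<union> K) (?L (insert t S)) w ^ m) w)"
    proof -
      have "laplacian_set \<nu> S (laplacian \<nu> t f) = laplacian_set \<nu> (insert t S) f" if "S \<in> Pow I" for S
        using that insert.hyps by (intro laplacian_set_insert[symmetric]) (auto intro: finite_subset)
      then show ?thesis using tN by (simp add: avg_sum avg_cmult)
    qed
    also have "\<dots> \<le> (\<Sum>S\<in>Pow I. (\<Prod>t\<in>S. \<tau> t) * (\<tau> t * avg \<nu> {t} (avg \<nu> (I \<union> K) (?L (insert t S))) w ^ m))"
      by (intro sum_mono mult_left_mono \<tau> tN avg_nonneg prod_nonneg \<tau>0) auto
    also have "\<dots> = (\<Sum>S\<in>Pow I. (\<Prod>t\<in>insert t S. \<tau> t) * avg \<nu> (insert t I \<union> K) (?L (insert t S)) w ^ m)"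
    proof (intro sum.cong refl)
      fix S assume "S \<in> Pow I"
      then have "finite S" "t \<notin> S" using insert.hyps(1) tI by (auto intro: finite_subset)
      then show "(\<Prod>t\<in>S. \<tau> t) * (\<tau> t * avg \<nu> {t} (avg \<nu> (I \<union> K) (?L (insert t S))) w ^ m) =
        (\<Prod>t\<in>insert t S. \<tau> t) * avg \<nu> (insert t I \<union> K) (?L (insert t S)) w ^ m"
        by (simp add: U avg_insert(1)[OF UN tU] mult_ac)
    qed
    finally show ?case by (simp add: sum_Pow_insert[OF insert.hyps(1) tI])
  qed
qed

end

section \<open>The price of one coordinate, and the passage to norms\<close>

text \<open>Every atom has mass at least \<open>p\<close>, so \<open>h \<le> E h / p\<close> on the
  support; this bounds \<open>k\<close> of the \<open>k + 1\<close> factors.\<close>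

lemma expectation_power_le:
  fixes h :: "'b \<Rightarrow> real"
  assumes "finite (set_pmf M)" "\<And>x. 0 \<le> h x" "0 < p" "\<And>x. x \<in> set_pmf M \<Longrightarrow> p \<le> pmf M x"
  shows "measure_pmf.expectation M (\<lambda>x. h x ^ Suc k)
    \<le> (1 / p) ^ k * measure_pmf.expectation M h ^ Suc k"
proof -
  let ?E = "measure_pmf.expectation M"
  have int: "integrable (measure_pmf M) g" for g :: "'b \<Rightarrow> real"
    using assms(1) by (rule integrable_measure_pmf_finite)
  have h: "h x \<le> ?E h / p" if "x \<in> set_pmf M" for x
  proof -
    have "h x * p \<le> h x * pmf M x" using that assms by (intro mult_left_mono) auto
    also have "\<dots> \<le> (\<Sum>x\<in>set_pmf M. h x * pmf M x)"
      using that assms by (intro member_le_sum) auto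
    also have "\<dots> = ?E h" using assms(1) by (simp add: integral_measure_pmf_real[where A="set_pmf M"])
    finally show ?thesis using assms(3) by (simp add: field_simps)
  qed
  have "?E (\<lambda>x. h x ^ Suc k) \<le> ?E (\<lambda>x. (?E h / p) ^ k * h x)"
    using h assms(2) by (intro integral_mono_AE int)
      (auto simp: AE_measure_pmf_iff mult.commute intro!: mult_left_mono power_mono)
  also have "\<dots> = (1 / p) ^ k * ?E h ^ Suc k" by (simp add: power_divide)
  finally show ?thesis .
qed

theorem theorem7p10:
  fixes n :: nat and \<Omega> :: "nat \<Rightarrow> 'a set" and \<nu> :: "nat \<Rightarrow> 'a pmf"
    and f :: "(nat \<Rightarrow> 'a) \<Rightarrow> real" and q :: nat and \<rho> :: real
  assumes "\<And>t. t \<in> {1..n} \<Longrightarrow> finite (\<Omega> t)"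
    and "\<And>t. t \<in> {1..n} \<Longrightarrow> set_pmf (\<nu> t) \<subseteq> \<Omega> t"
    and "\<And>t. t \<in> {1..n} \<Longrightarrow> 0 < min_prob \<Omega> \<nu> t \<and> min_prob \<Omega> \<nu> t < 1 / 2"
    and "even q" and "q > 2"
    and "0 \<le> \<rho>" and "\<rho> \<le> 1 / (8 * real q powr (3 / 2))"
  shows "Lq_norm n \<nu> (real q) (noise n \<nu> \<rho> f) ^ q
    \<le> (\<Sum>S\<in>Pow {1..n}. sigma_set \<Omega> \<nu> S powr (2 - real q) * Lq_norm n \<nu> 2 (laplacian_set \<nu> S f) ^ q)"
proof -
  obtain m where q: "q = 2 * m" using assms(4) by blast
  have m: "2 \<le> m" using assms(5) q by simp
  define p where "p = min_prob \<Omega> \<nu>"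
  define \<tau> where "\<tau> t = sigma \<Omega> \<nu> t powr (2 - real q)" for t
  interpret finite_factors \<nu> "{1..n}"
    using assms(1,2) by unfold_locales (auto intro: finite_subset)
  have norm: "Lq_norm n \<nu> r g ^ q = avg \<nu> {1..n} (\<lambda>w. \<bar>g w\<bar> powr r) (\<lambda>_. undefined) powr (real q / r)"
    for r g
  proof -
    have "measure_pmf.expectation (prod_space n \<nu>) h = avg \<nu> {1..n} h (\<lambda>_. undefined)"
      for h :: "_ \<Rightarrow> real"
    proof -
      \<comment> \<open>Samples equal the default \<open>undefined\<close> outside
        \<open>{1..n}\<close>, so the base point \<open>\<lambda>_. undefined\<close> reproduces
        them.\<close>
      have "y = override_on (\<lambda>_. undefined) y {1..n}" if "y \<in> set_pmf (Pi_pmf {1..n} undefined \<nu>)" for y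
        using that by (auto simp: set_Pi_pmf PiE_dflt_def override_on_def)
      then show ?thesis unfolding avg_def prod_space_def
        by (intro integral_cong_AE) (auto simp: AE_measure_pmf_iff)
    qed
    moreover have "(x powr (1 / r)) ^ q = x powr (real q / r)" for x :: real
      using assms(5) powr_realpow'[of "x powr (1 / r)" q] by (simp add: powr_powr)
    ultimately show ?thesis by (simp add: Lq_norm_def)
  qed
  have avg_powr_2: "avg \<nu> {1..n} (\<lambda>w. \<bar>g w\<bar> powr 2) = avg \<nu> {1..n} (\<lambda>w. (g w)\<^sup>2)" for g :: "_ \<Rightarrow> real"
    by simp
  \<comment> \<open>Note \<open>16 * m = 8 * q\<close> and
    \<open>q \<le> q powr (3/2)\<close>.\<close>
  have rho: "16 * real m * \<rho> \<le> 1"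
  proof -
    have "real q powr 1 \<le> real q powr (3/2)" using assms(5) by (intro powr_mono) auto
    then have "real q * \<rho> \<le> real q powr (3/2) * \<rho>" using assms(6) by (intro mult_right_mono) auto
    also have "\<dots> \<le> 1 / 8" using assms(5,7) by (simp add: field_simps)
    finally show ?thesis by (simp add: q)
  qed
  have \<tau>: "avg \<nu> {t} (\<lambda>w. g w ^ m) w \<le> \<tau> t * avg \<nu> {t} g w ^ m"
    if t: "t \<in> {1..n}" and g: "\<And>w. 0 \<le> g w" for t g w
  proof -
    have p: "0 < p t" "p t < 1/2" using assms(3)[OF t] by (auto simp: p_def)
    have pmf: "p t \<le> pmf (\<nu> t) x" if "x \<in> set_pmf (\<nu> t)" for x
      using assms(1,2)[OF t] that by (auto simp: p_def min_prob_def intro!: Min_le)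
    have "avg \<nu> {t} (\<lambda>w. g w ^ m) w \<le> (1 / p t) ^ (m - 1) * avg \<nu> {t} g w ^ m"
      using expectation_power_le[OF finite_support[OF t] g p(1) pmf, of "\<lambda>x. w(t := x)" "m - 1"] m
      by (simp add: avg_singleton del: power_Suc)
    also have "\<dots> \<le> \<tau> t * avg \<nu> {t} g w ^ m"
    proof (intro mult_right_mono)
      have s: "0 < p t * (1 - p t)" using p by simp
      \<comment> \<open>\<open>sigma\<close> is the square root of \<open>p * (1 - p)\<close> and
        \<open>2 - q = - 2 * (m - 1)\<close>; passing from \<open>1 / p\<close> to
        \<open>1 / (p * (1 - p))\<close> only increases the bound.\<close>
      have "\<tau> t = (p t * (1 - p t)) powr (- real (m - 1))"
        using s m unfolding \<tau>_def sigma_def p_def[symmetric]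
        by (simp add: q powr_half_sqrt[symmetric] powr_powr of_nat_diff algebra_simps)
      also have "\<dots> = (1 / (p t * (1 - p t))) ^ (m - 1)"
        using s by (simp add: powr_minus powr_realpow power_one_over inverse_eq_divide)
      also have "\<dots> \<ge> (1 / p t) ^ (m - 1)"
        using p by (intro power_mono divide_left_mono) (auto simp: mult_le_cancel_left1)
      finally show "(1 / p t) ^ (m - 1) \<le> \<tau> t" .
    qed (simp add: avg_nonneg g)
    finally show ?thesis .
  qed
  have noise: "noise n \<nu> \<rho> f = noise_on \<rho> {1..n} f"
    by (rule ext) (simp add: noise_def noise_on_def efron_stein_def)
  \<comment> \<open>With \<open>K = {}\<close> the inner average is the identity, and
    \<open>(x\<^sup>2) ^ m\<close> is the \<open>q\<close>-th power of
    \<open>\<bar>x\<bar>\<close>.\<close>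
  have "Lq_norm n \<nu> (real q) (noise n \<nu> \<rho> f) ^ q
      = avg \<nu> {1..n} (\<lambda>w. avg \<nu> {} (\<lambda>w. (noise_on \<rho> {1..n} f w)\<^sup>2) w ^ m) (\<lambda>_. undefined)"
  proof -
    have "\<bar>x\<bar> powr real q = (x\<^sup>2) ^ m" for x :: real
      using m powr_realpow'[of "\<bar>x\<bar>" q] assms(5) by (simp add: q power_mult)
    then show ?thesis using assms(5) by (simp add: norm noise avg_nonneg)
  qed
  also have "\<dots> \<le> (\<Sum>S\<in>Pow {1..n}. (\<Prod>t\<in>S. \<tau> t) *
      avg \<nu> ({1..n} \<union> {}) (\<lambda>w. (laplacian_set \<nu> S f w)\<^sup>2) (\<lambda>_. undefined) ^ m)"
    using m \<tau> by (intro noise_on_power_bound assms(6) rho) (auto simp: \<tau>_def)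
  also have "\<dots> = (\<Sum>S\<in>Pow {1..n}. sigma_set \<Omega> \<nu> S powr (2 - real q) * Lq_norm n \<nu> 2 (laplacian_set \<nu> S f) ^ q)"
  proof (intro sum.cong refl)
    fix S assume "S \<in> Pow {1..n}"
    then have S: "0 \<le> sigma \<Omega> \<nu> t" if "t \<in> S" for t
      using assms(3)[of t] that by (auto simp: sigma_def)
    have "(\<Prod>t\<in>S. \<tau> t) = sigma_set \<Omega> \<nu> S powr (2 - real q)"
      unfolding \<tau>_def sigma_set_def using S by (intro prod_powr_distrib[symmetric])
    moreover have "x ^ m = x powr (real q / 2)" if "0 \<le> x" for x :: real
      using that m by (simp add: q powr_realpow')
    ultimately show "(\<Prod>t\<in>S. \<tau> t) * avg \<nu> ({1..n} \<union> {}) (\<lambda>w. (laplacian_set \<nu> S f w)\<^sup>2) (\<lambda>_. undefined) ^ m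
      = sigma_set \<Omega> \<nu> S powr (2 - real q) * Lq_norm n \<nu> 2 (laplacian_set \<nu> S f) ^ q"
      by (simp add: norm avg_powr_2 avg_nonneg)
  qed
  finally show ?thesis .
qed

end
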